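(* Let $(X,f)$ be a topologically weakly mixing dynamical system, where $X$ is a (nonempty) compact metric space with metric $d$ and $f:X\to X$ is continuous. Then: 1. $\mathbb{L}_d=\overline{\mathbb{L}}_d=\mathrm{diam}(X)$. 2. $\mathbb{L}_r=\overline{\mathbb{L}}_r$. 3. If, in addition, $(X,f)$ is minimal, then $\mathbb{L}_r=\overline{\mathbb{L}}_r=\mathbb{L}_d=\overline{\mathbb{L}}_d=\mathrm{diam}(X)$.
   Context: A topological dynamical system $(X,f)$ is a nonempty compact metric space $(X,d)$ together with a continuous map $f:X\to X$. "Opene" means open and nonempty. $\mathrm{diam}(X)=\sup\{d(x,y):x,y\in X\}$. $(X,f)$ is (topologically) weakly mixing if for any opene $U_1,U_2,V_1,V_2\subset X$ there is an integer $n\ge 0$ such that $U_1\cap f^{-n}(V_1)\neq\varnothing$ and $U_2\cap f^{-n}(V_2)\neq\varnothing$; in other words, the product system $(X\times X,f\times f)$ is topologically transitive. $(X,f)$ is minimal if the orbit $\{x,f(x),f^2(x),\dots\}$ of every point $x\in X$ is dense in $X$. The four Lyapunov numbers of $(X,f)$ are (suprema over real numbers $\varepsilon$): $$\mathbb{L}_r=\sup\{\varepsilon:\ \text{for every } x\in X \text{ and every neighborhood } U_x \text{ of } x \text{ there exist } y\in U_x \text{ and an integer } n\ge 0 \text{ with } d(f^n(x),f^n(y))>\varepsilon\},$$ $$\mathbb{L}_d=\sup\{\varepsilon:\ \text{in any opene } U\subset X \text{ there exist } x,y\in U \text{ and a positive integer } n \text{ with } d(f^n(x),f^n(y))>\varepsilon\},$$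 $$\overline{\mathbb{L}}_r=\sup\{\varepsilon:\ \text{for every } x\in X \text{ and every open neighborhood } U_x \text{ of } x \text{ there exists } y\in U_x \text{ with } \limsup_{n\to\infty} d(f^n(x),f^n(y))>\varepsilon\},$$ $$\overline{\mathbb{L}}_d=\sup\{\varepsilon:\ \text{in any opene } U\subset X \text{ there exist } x,y\in U \text{ with } \limsup_{n\to\infty} d(f^n(x),f^n(y))>\varepsilon\}.$$ *)

theory Defs
  imports "HOL-Analysis.Analysis"
begin

text \<open>
  A system lives on a nonempty compact subset \<open>X\<close> of an ambient metric space, with a map \<open>f\<close> of the
  ambient type that only matters on \<open>X\<close>.  All topological notions are relative to \<open>X\<close>.
\<close>

definition dynamical_system :: "'a::metric_space set \<Rightarrow> ('a \<Rightarrow> 'a) \<Rightarrow> bool" where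
  "dynamical_system X f \<longleftrightarrow> X \<noteq> {} \<and> compact X \<and> continuous_on X f \<and> f ` X \<subseteq> X"

definition opene :: "'a::topological_space set \<Rightarrow> 'a set \<Rightarrow> bool" where
  "opene X U \<longleftrightarrow> openin (top_of_set X) U \<and> U \<noteq> {}"

definition nbhd :: "'a::topological_space set \<Rightarrow> 'a \<Rightarrow> 'a set \<Rightarrow> bool" where
  "nbhd X x U \<longleftrightarrow> U \<subseteq> X \<and> (\<exists>V. openin (top_of_set X) V \<and> x \<in> V \<and> V \<subseteq> U)"

text \<open>Below, \<open>(f ^^ n) -` V\<close> is the preimage in the whole type; it is always intersected with a
  subset of \<open>X\<close>.\<close>

definition weakly_mixing :: "'a::metric_space set \<Rightarrow> ('a \<Rightarrow> 'a) \<Rightarrow> bool" where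
  "weakly_mixing X f \<longleftrightarrow>
     (\<forall>U1 U2 V1 V2. opene X U1 \<and> opene X U2 \<and> opene X V1 \<and> opene X V2 \<longrightarrow>
        (\<exists>n. U1 \<inter> (f ^^ n) -` V1 \<noteq> {} \<and> U2 \<inter> (f ^^ n) -` V2 \<noteq> {}))"

definition minimal_system :: "'a::metric_space set \<Rightarrow> ('a \<Rightarrow> 'a) \<Rightarrow> bool" where
  "minimal_system X f \<longleftrightarrow> (\<forall>x\<in>X. X \<subseteq> closure (range (\<lambda>n. (f ^^ n) x)))"

text \<open>
  For a dynamical system, each of the four sets below contains every negative real and is bounded
  above by \<open>diameter X\<close>, so the real \<open>Sup\<close> is the genuine supremum.  The limes superior is taken in
  \<^typ>\<open>ereal\<close>, as \<open>limsup\<close> needs a complete lattice; the sequences are bounded, so it agrees with the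
  real one.
\<close>

definition Lyap_r :: "'a::metric_space set \<Rightarrow> ('a \<Rightarrow> 'a) \<Rightarrow> real" where
  "Lyap_r X f = Sup {\<epsilon>::real. \<forall>x\<in>X. \<forall>U. nbhd X x U \<longrightarrow>
     (\<exists>y\<in>U. \<exists>n. dist ((f ^^ n) x) ((f ^^ n) y) > \<epsilon>)}"

definition Lyap_d :: "'a::metric_space set \<Rightarrow> ('a \<Rightarrow> 'a) \<Rightarrow> real" where
  "Lyap_d X f = Sup {\<epsilon>::real. \<forall>U. opene X U \<longrightarrow>
     (\<exists>x\<in>U. \<exists>y\<in>U. \<exists>n>0. dist ((f ^^ n) x) ((f ^^ n) y) > \<epsilon>)}"

definition Lyap_r_bar :: "'a::metric_space set \<Rightarrow> ('a \<Rightarrow> 'a) \<Rightarrow> real" where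
  "Lyap_r_bar X f = Sup {\<epsilon>::real. \<forall>x\<in>X. \<forall>U. openin (top_of_set X) U \<and> x \<in> U \<longrightarrow>
     (\<exists>y\<in>U. limsup (\<lambda>n. ereal (dist ((f ^^ n) x) ((f ^^ n) y))) > ereal \<epsilon>)}"

definition Lyap_d_bar :: "'a::metric_space set \<Rightarrow> ('a \<Rightarrow> 'a) \<Rightarrow> real" where
  "Lyap_d_bar X f = Sup {\<epsilon>::real. \<forall>U. opene X U \<longrightarrow>
     (\<exists>x\<in>U. \<exists>y\<in>U. limsup (\<lambda>n. ereal (dist ((f ^^ n) x) ((f ^^ n) y))) > ereal \<epsilon>)}"

end

theory Submission
  imports Defs
begin

text \<open>
  Write \<open>N(U, V)\<close> for the set of times \<open>n\<close> at which \<open>f\<^sup>n\<close> carries a point of \<open>U\<close> into \<open>V\<close>.  By an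
  argument of Furstenberg, weak mixing makes these sets a filter base: if \<open>m\<close> lies in
  \<open>N(U1, U2) \<inter> N(V1, V2)\<close>, then \<open>N(U1 \<inter> f\<^sup>-\<^sup>m U2, V1 \<inter> f\<^sup>-\<^sup>m V2)\<close> is contained in both \<open>N(U1, V1)\<close> and
  \<open>N(U2, V2)\<close>, because \<open>f\<^sup>m\<close> and \<open>f\<^sup>n\<close> commute.  As each single set of times is infinite, finitely
  many opene sets can be steered into finitely many opene targets at the same, arbitrarily late, time
  (\<open>infinite_common_hitting_times\<close>).

  This gives all three parts.  A limes superior that is at least \<open>e\<close> is obtained by Baire's theorem
  from a dense set of points whose orbits exceed \<open>e\<close> at some late time
  (\<open>generic_limsup_ge\<close>), so it suffices to produce late separations.

  For pairs, let \<open>dist a b > e\<close>.  Any two opene sets can be steered, at a common late time, close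
  to \<open>a\<close> and close to \<open>b\<close>; hence generic pairs in \<open>U \<times> U\<close> separate by almost the diameter infinitely
  often.

  For a fixed point \<open>x\<close>, suppose that every point \<open>u\<close> of \<open>X\<close> is separated by more than \<open>e\<close> from
  some point at some time \<open>n\<close>, with no condition on how close the two points are.  This persists if
  \<open>u\<close> varies in an opene set \<open>O\<close> and its partner in an opene set \<open>P\<close>, and by compactness finitely
  many such \<open>O\<close> cover \<open>X\<close>.  Steer a given opene set \<open>W\<close> into all the finitely many \<open>P\<close> at one late
  time \<open>k\<close>.  Wherever \<open>f\<^sup>k x\<close> happens to be, it lies in one of the sets \<open>O\<close>, and a point of \<open>W\<close> is
  in the matching \<open>P\<close> at that time; these two separate \<open>n\<close> steps later.  So the points \<open>y\<close> that are
  separated from \<open>x\<close> infinitely often are dense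
  (\<open>ex_limsup_ge_of_all_separated\<close>), which turns sensitivity into its limes superior form.

  In a minimal system the separation hypothesis holds for every \<open>e\<close> below the diameter: the orbit of
  \<open>u\<close> visits a neighbourhood of \<open>a\<close> at some time \<open>n\<close>, and the orbit of \<open>f\<^sup>n u\<close> visits a neighbourhood
  of \<open>b\<close>, so some \<open>f\<^sup>j u\<close> is near \<open>b\<close> at time \<open>n\<close>.
\<close>

section \<open>Suprema, limits superior and Baire category\<close>

lemma Sup_eqI_lessThan_atMost:
  fixes c :: real
  assumes "{..<c} \<subseteq> S" and "S \<subseteq> {..c}"
  shows "Sup S = c"
proof (rule cSup_eq_non_empty)
  show "S \<noteq> {}"
    using assms(1) by (metis empty_iff lessThan_iff lt_ex subsetD)
  show "x \<le> c" if "x \<in> S" for x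
    using assms(2) that by auto
  show "c \<le> y" if "\<And>x. x \<in> S \<Longrightarrow> x \<le> y" for y
    by (rule dense_le) (use assms(1) that in auto)
qed

lemma Sup_eq_if_interleaved:
  fixes A B :: "real set"
  assumes "A \<subseteq> B" and "bdd_above B" and below: "\<And>b e. b \<in> B \<Longrightarrow> e < b \<Longrightarrow> e \<in> A"
  shows "Sup A = Sup B"
proof (cases "B = {}")
  case True
  then show ?thesis using assms(1) by simp
next
  case False
  then obtain b where "b \<in> B" by blast
  then have ne: "A \<noteq> {}" using below[of b "b - 1"] by auto
  have bdd: "bdd_above A" by (rule bdd_above_mono[OF assms(2,1)])
  have "b \<le> Sup A" if "b \<in> B" for b
    by (rule dense_le) (intro cSup_upper below[OF that] bdd)
  then have "Sup B \<le> Sup A" using False by (intro cSup_least) auto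
  moreover have "Sup A \<le> Sup B" using assms ne by (intro cSup_subset_mono) auto
  ultimately show ?thesis by simp
qed

lemma limsup_ge_if_often_greater:
  fixes a :: "nat \<Rightarrow> real"
  assumes "\<And>N. \<exists>n\<ge>N. e < a n"
  shows "ereal e \<le> limsup (\<lambda>n. ereal (a n))"
proof (rule ccontr)
  assume "\<not> ?thesis"
  then have "eventually (\<lambda>n. ereal (a n) < ereal e) sequentially"
    by (intro Limsup_lessD) simp
  then obtain N where "\<And>n. n \<ge> N \<Longrightarrow> a n < e"
    by (auto simp: eventually_sequentially)
  then show False using assms[of N] by fastforce
qed

lemma ex_greater_if_limsup_greater:
  fixes a :: "nat \<Rightarrow> real"
  assumes "ereal e < limsup (\<lambda>n. ereal (a n))"
  shows "\<exists>n\<ge>N. e < a n"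
proof (rule ccontr)
  assume "\<not> ?thesis"
  then have "eventually (\<lambda>n. ereal (a n) \<le> ereal e) sequentially"
    unfolding eventually_sequentially by (auto simp: not_less)
  then show False using Limsup_bounded assms by (metis not_less)
qed

lemma opene_meets_countable_Inter:
  fixes G :: "nat \<Rightarrow> 'a::metric_space set"
  assumes "compact K" and W: "opene K W"
    and G: "\<And>N. openin (top_of_set K) (G N)"
    and dense: "\<And>N V. opene K V \<Longrightarrow> V \<inter> G N \<noteq> {}"
  shows "\<exists>w\<in>W. \<forall>N. w \<in> G N"
proof -
  have "top_of_set K closure_of \<Inter>(range G) = topspace (top_of_set K)"
  proof (rule Baire_category)
    have "compact_space (top_of_set K)"
      using \<open>compact K\<close> by (simp add: compact_space_subtopology)
    moreover have "Hausdorff_space (top_of_set K)"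
      by (simp add: Hausdorff_space_subtopology)
    ultimately show "completely_metrizable_space (top_of_set K) \<or>
        locally_compact_space (top_of_set K) \<and> regular_space (top_of_set K)"
      by (simp add: compact_imp_locally_compact_space
          compact_Hausdorff_imp_regular_space)
    show "openin (top_of_set K) T \<and> top_of_set K closure_of T = topspace (top_of_set K)"
      if T: "T \<in> range G" for T
    proof
      show "openin (top_of_set K) T" using T G by blast
      show "top_of_set K closure_of T = topspace (top_of_set K)"
        unfolding dense_intersects_open using T dense unfolding opene_def by blast
    qed
  qed simp
  then have "\<Inter>(range G) \<inter> W \<noteq> {}"
    using W unfolding dense_intersects_open opene_def by blast
  then show ?thesis by blast
qed

text \<open>For each \<open>N\<close> the points at which some \<open>g n\<close> with \<open>n \<ge> N\<close> exceeds \<open>e\<close> form an open set, and the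
  hypothesis says that it is dense.  A point in all of these sets has infinitely many values above
  \<open>e\<close>.\<close>

lemma generic_limsup_ge:
  fixes g :: "nat \<Rightarrow> 'a::metric_space \<Rightarrow> real"
  assumes "compact K" and W: "opene K W"
    and cont: "\<And>n. continuous_on K (g n)"
    and late: "\<And>N V. opene K V \<Longrightarrow> \<exists>v\<in>V. \<exists>n\<ge>N. e < g n v"
  shows "\<exists>w\<in>W. ereal e \<le> limsup (\<lambda>n. ereal (g n w))"
proof -
  define G where "G N = (\<Union>n\<in>{N..}. K \<inter> g n -` {e<..})" for N
  have "openin (top_of_set K) (G N)" for N
    unfolding G_def using cont by (intro openin_Union) (auto intro: continuous_openin_preimage_gen)
  moreover have "V \<inter> G N \<noteq> {}" if V: "opene K V" for V N
  proof -
    obtain v n where "v \<in> V" "n \<ge> N" "e < g n v" using late[OF V] by blast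
    moreover have "V \<subseteq> K" using V openin_imp_subset unfolding opene_def by blast
    ultimately show ?thesis unfolding G_def by auto
  qed
  ultimately have "\<exists>w\<in>W. \<forall>N. w \<in> G N"
    by (intro opene_meets_countable_Inter[OF \<open>compact K\<close> W])
  then obtain w where "w \<in> W" and w: "\<And>N. w \<in> G N" by blast
  have "\<exists>n\<ge>N. e < g n w" for N
    using w[of N] unfolding G_def by auto
  then have "ereal e \<le> limsup (\<lambda>n. ereal (g n w))" by (rule limsup_ge_if_often_greater)
  then show ?thesis using \<open>w \<in> W\<close> by blast
qed

section \<open>Iterates and opene sets\<close>

lemma opene_subset: "opene X U \<Longrightarrow> U \<subseteq> X"
  unfolding opene_def using openin_imp_subset by blast

lemma iterate_mem:
  assumes "dynamical_system X f" "x \<in> X"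
  shows "(f ^^ n) x \<in> X"
  using assms by (induction n) (auto simp: dynamical_system_def)

lemma continuous_on_iterate:
  assumes "dynamical_system X f"
  shows "continuous_on X (f ^^ n)"
proof (induction n)
  case (Suc n)
  have "(f ^^ n) ` X \<subseteq> X" using iterate_mem[OF assms] by auto
  then have "continuous_on ((f ^^ n) ` X) f"
    using assms continuous_on_subset unfolding dynamical_system_def by blast
  then show ?case unfolding funpow.simps by (rule continuous_on_compose[OF Suc])
qed auto

lemma iterate_add_apply: "(f ^^ (m + n)) x = (f ^^ m) ((f ^^ n) x)"
  by (simp add: funpow_add)

lemma openin_iterate_vimage:
  assumes "dynamical_system X f" "openin (top_of_set X) V"
  shows "openin (top_of_set X) (X \<inter> (f ^^ n) -` V)"
  using continuous_on_iterate[OF assms(1)] iterate_mem[OF assms(1)] assms(2)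
  by (intro continuous_openin_preimage) auto

lemma opene_ball:
  assumes "a \<in> X" "r > 0"
  shows "opene X (X \<inter> ball a r)"
  using assms by (auto simp: opene_def intro!: openin_open_Int)

lemma bounded_dynamical_system: "dynamical_system X f \<Longrightarrow> bounded X"
  by (simp add: dynamical_system_def compact_imp_bounded)

lemma dist_iterates_le_diameter:
  assumes "dynamical_system X f" "x \<in> X" "y \<in> X"
  shows "dist ((f ^^ n) x) ((f ^^ n) y) \<le> diameter X"
  using assms by (intro diameter_bounded_bound iterate_mem bounded_dynamical_system)

lemma continuous_on_dist_iterates:
  assumes "dynamical_system X f"
  shows "continuous_on (X \<times> X) (\<lambda>p. dist ((f ^^ n) (fst p)) ((f ^^ n) (snd p)))"
  by (intro continuous_on_dist continuous_on_compose2[OF continuous_on_iterate[OF assms]]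
      continuous_on_fst continuous_on_snd continuous_on_id) auto

section \<open>Hitting times under weak mixing\<close>

definition hitting_times :: "('a \<Rightarrow> 'a) \<Rightarrow> 'a set \<Rightarrow> 'a set \<Rightarrow> nat set" where
  "hitting_times f U V = {n. \<exists>u\<in>U. (f ^^ n) u \<in> V}"

lemma weakly_mixingD:
  assumes "weakly_mixing X f" "opene X U1" "opene X U2" "opene X V1" "opene X V2"
  shows "hitting_times f U1 V1 \<inter> hitting_times f U2 V2 \<noteq> {}"
proof -
  obtain n where "U1 \<inter> (f ^^ n) -` V1 \<noteq> {}" "U2 \<inter> (f ^^ n) -` V2 \<noteq> {}"
    using assms unfolding weakly_mixing_def by meson
  then have "n \<in> hitting_times f U1 V1 \<inter> hitting_times f U2 V2"
    unfolding hitting_times_def by blast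
  then show ?thesis by blast
qed

lemma hitting_times_mono:
  "U' \<subseteq> U \<Longrightarrow> V' \<subseteq> V \<Longrightarrow> hitting_times f U' V' \<subseteq> hitting_times f U V"
  unfolding hitting_times_def by blast

text \<open>An isolated point \<open>p\<close> cannot be steered into two disjoint sets at the same time, so an isolated
  point is the whole space.\<close>

lemma finite_opene_imp_singleton:
  fixes X :: "'a::metric_space set"
  assumes wm: "weakly_mixing X f" and V: "opene X V" and fin: "finite V"
  shows "\<exists>p. X = {p}"
proof -
  obtain p where "p \<in> V" using V unfolding opene_def by blast
  have "open (- (V - {p}))" using fin by (intro open_Compl finite_imp_closed finite_Diff)
  then have "openin (top_of_set X) (V \<inter> - (V - {p}))"
    using V unfolding opene_def by (intro openin_Int_open) auto
  moreover have "V \<inter> - (V - {p}) = {p}" using \<open>p \<in> V\<close> by blast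
  ultimately have p: "opene X {p}" by (simp add: opene_def)
  have "q = p" if "q \<in> X" for q
  proof (rule ccontr)
    assume "q \<noteq> p"
    then have "opene X (X \<inter> - {p})"
      using \<open>q \<in> X\<close> by (auto simp: opene_def intro!: openin_open_Int)
    then show False using weakly_mixingD[OF wm p p p, of "X \<inter> - {p}"]
      unfolding hitting_times_def by auto
  qed
  then show ?thesis using \<open>p \<in> V\<close> opene_subset[OF V] by blast
qed

text \<open>To force a hitting time beyond \<open>N\<close>, shrink the target to a small ball that misses the first
  \<open>N\<close> points of the orbit of some \<open>u \<in> U\<close>, and shrink \<open>U\<close> to the points that still miss this ball
  up to time \<open>N\<close>.\<close>

lemma infinite_hitting_times:
  fixes X :: "'a::metric_space set"
  assumes ds: "dynamical_system X f" and wm: "weakly_mixing X f"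
    and U: "opene X U" and V: "opene X V"
  shows "infinite (hitting_times f U V)"
proof (cases "finite V")
  case True
  then obtain p where p: "X = {p}" using finite_opene_imp_singleton[OF wm V] by blast
  then have "U = {p}" "V = {p}"
    using U V opene_subset[OF U] opene_subset[OF V] by (auto simp: opene_def)
  moreover have "(f ^^ n) p = p" for n using iterate_mem[OF ds, of p n] p by simp
  ultimately have "hitting_times f U V = UNIV" unfolding hitting_times_def by simp
  then show ?thesis by simp
next
  case False
  have "\<exists>n\<ge>N. n \<in> hitting_times f U V" for N
  proof -
    obtain u where u: "u \<in> U" using U unfolding opene_def by blast
    \<comment> \<open>The early orbit of \<open>u\<close> is a finite set, so it cannot exhaust the infinite target \<open>V\<close>.\<close>
    define F where "F = (\<lambda>i. (f ^^ i) u) ` {..<N}"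
    have "finite F" unfolding F_def by simp
    then obtain v where v: "v \<in> V" "v \<notin> F" using False by (meson finite_subset subsetI)
    obtain r where "r > 0" and r: "\<And>z. z \<in> F \<Longrightarrow> r < dist v z"
    proof -
      have "open (- F)" using \<open>finite F\<close> by (simp add: finite_imp_closed open_Compl)
      then obtain r where r: "r > 0" "cball v r \<subseteq> - F" using v open_contains_cball by blast
      have "r < dist v z" if "z \<in> F" for z
        using r(2) that by (metis ComplD mem_cball not_less subsetD)
      then show ?thesis using that r(1) by blast
    qed
    define U' where "U' = U \<inter> (\<Inter>i\<in>{..<N}. X \<inter> (f ^^ i) -` (X \<inter> - cball v r))"
    have "openin (top_of_set X) (X \<inter> - cball v r)"
      by (intro openin_open_Int open_Compl closed_cball)
    then have "openin (top_of_set X) (X \<inter> (f ^^ i) -` (X \<inter> - cball v r))" for i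
      by (rule openin_iterate_vimage[OF ds])
    then have open_U': "openin (top_of_set X) U'"
    proof (cases "N = 0")
      case False
      then have "openin (top_of_set X) (\<Inter>i\<in>{..<N}. X \<inter> (f ^^ i) -` (X \<inter> - cball v r))"
        using \<open>\<And>i. openin (top_of_set X) (X \<inter> (f ^^ i) -` (X \<inter> - cball v r))\<close>
        by (intro openin_INT2) auto
      then show ?thesis using U unfolding U'_def opene_def by (intro openin_Int) auto
    qed (use U in \<open>simp add: U'_def opene_def\<close>)
    have "u \<in> U'"
      using u r opene_subset[OF U] iterate_mem[OF ds, of u] unfolding U'_def F_def
      by (auto simp: not_le)
    with open_U' have U': "opene X U'" unfolding opene_def by blast
    have V': "opene X (V \<inter> ball v r)"
      using V v \<open>r > 0\<close> by (auto simp: opene_def intro: openin_Int_open)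
    obtain n where n: "n \<in> hitting_times f U' (V \<inter> ball v r)"
      using weakly_mixingD[OF wm U' U' V' V'] by blast
    then obtain w where w: "w \<in> U'" "(f ^^ n) w \<in> ball v r"
      unfolding hitting_times_def by blast
    have "n \<ge> N"
    proof (rule ccontr)
      assume "\<not> n \<ge> N"
      then have "n \<in> {..<N}" by simp
      then have "(f ^^ n) w \<notin> cball v r" using w(1) unfolding U'_def by blast
      then show False using w(2) by auto
    qed
    moreover have "n \<in> hitting_times f U V"
      using n hitting_times_mono[of U' U "V \<inter> ball v r" V] unfolding U'_def by blast
    ultimately show ?thesis by blast
  qed
  then show ?thesis by (auto simp: infinite_nat_iff_unbounded_le)
qed

text \<open>Furstenberg's argument: after the step that merges \<open>(U, V)\<close> into \<open>(U', V')\<close>, a point \<open>u\<close> of the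
  new source with \<open>f\<^sup>n u\<close> in the new target witnesses \<open>n\<close> for \<open>(U', V')\<close>, while \<open>f\<^sup>m u\<close> witnesses it for
  \<open>(U, V)\<close>.\<close>

lemma hitting_times_filter_base:
  fixes X :: "'a::metric_space set"
  assumes ds: "dynamical_system X f" and wm: "weakly_mixing X f"
    and "finite Q" and "\<And>U V. (U, V) \<in> Q \<Longrightarrow> opene X U \<and> opene X V"
  shows "\<exists>U' V'. opene X U' \<and> opene X V' \<and>
    (\<forall>(U, V)\<in>Q. hitting_times f U' V' \<subseteq> hitting_times f U V)"
  using assms(3,4)
proof (induction Q rule: finite_induct)
  case empty
  have "opene X X" using ds by (simp add: opene_def dynamical_system_def)
  then show ?case by blast
next
  case (insert q Q)
  then obtain U' V' where U': "opene X U'" and V': "opene X V'"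
    and IH: "\<And>U V. (U, V) \<in> Q \<Longrightarrow> hitting_times f U' V' \<subseteq> hitting_times f U V"
    by blast
  obtain U V where q: "q = (U, V)" by fastforce
  then have U: "opene X U" and V: "opene X V" using insert.prems by auto
  obtain m where m: "m \<in> hitting_times f U' U" "m \<in> hitting_times f V' V"
    using weakly_mixingD[OF wm U' V' U V] by blast
  define U'' where "U'' = U' \<inter> (X \<inter> (f ^^ m) -` U)"
  define V'' where "V'' = V' \<inter> (X \<inter> (f ^^ m) -` V)"
  have "opene X U''"
    using m(1) U U' opene_subset[OF U'] openin_iterate_vimage[OF ds, of U m]
    unfolding opene_def U''_def hitting_times_def by blast
  moreover have "opene X V''"
    using m(2) V V' opene_subset[OF V'] openin_iterate_vimage[OF ds, of V m]
    unfolding opene_def V''_def hitting_times_def by blast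
  moreover have "hitting_times f U'' V'' \<subseteq> hitting_times f U' V'"
    by (rule hitting_times_mono) (auto simp: U''_def V''_def)
  moreover have "hitting_times f U'' V'' \<subseteq> hitting_times f U V"
  proof
    fix n assume "n \<in> hitting_times f U'' V''"
    then obtain u where u: "u \<in> U''" "(f ^^ n) u \<in> V''" unfolding hitting_times_def by blast
    then have "(f ^^ m) u \<in> U" "(f ^^ m) ((f ^^ n) u) \<in> V"
      unfolding U''_def V''_def by auto
    moreover have "(f ^^ m) ((f ^^ n) u) = (f ^^ n) ((f ^^ m) u)"
      by (metis iterate_add_apply add.commute)
    ultimately show "n \<in> hitting_times f U V" unfolding hitting_times_def by auto
  qed
  ultimately show ?case using IH q by (intro exI[of _ U''] exI[of _ V'']) blast
qed

lemma infinite_common_hitting_times: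
  fixes X :: "'a::metric_space set"
  assumes "dynamical_system X f" "weakly_mixing X f"
    and "finite Q" "\<And>U V. (U, V) \<in> Q \<Longrightarrow> opene X U \<and> opene X V"
  shows "\<exists>n\<ge>N. \<forall>(U, V)\<in>Q. \<exists>u\<in>U. (f ^^ n) u \<in> V"
proof -
  obtain U' V' where "opene X U'" "opene X V'"
    and sub: "\<forall>(U, V)\<in>Q. hitting_times f U' V' \<subseteq> hitting_times f U V"
    using hitting_times_filter_base[OF assms] by blast
  then have "infinite (hitting_times f U' V')" using infinite_hitting_times assms by blast
  then obtain n where "n \<ge> N" "n \<in> hitting_times f U' V'"
    by (auto simp: infinite_nat_iff_unbounded_le)
  then show ?thesis using sub unfolding hitting_times_def by blast
qed

section \<open>Separation along infinitely many times\<close>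

lemma dist_greater_if_near:
  fixes a b :: "'a::metric_space"
  assumes "dist a p < (dist a b - e) / 2" "dist b q < (dist a b - e) / 2"
  shows "e < dist p q"
  using assms dist_triangle[of a b p] dist_triangle[of p b q]
  by (simp add: dist_commute)

text \<open>The genericity argument runs on \<open>X \<times> X\<close>, where the sequence attached to a pair is the distance of
  the two orbits; weak mixing is used on the two sides of a product rectangle.\<close>

lemma ex_pair_limsup_ge:
  fixes X :: "'a::metric_space set"
  assumes ds: "dynamical_system X f" and wm: "weakly_mixing X f" and U: "opene X U"
    and ab: "a \<in> X" "b \<in> X" "e < dist a b"
  shows "\<exists>x\<in>U. \<exists>y\<in>U. ereal e \<le> limsup (\<lambda>n. ereal (dist ((f ^^ n) x) ((f ^^ n) y)))"
proof -
  have "\<exists>p\<in>S. \<exists>n\<ge>N. e < dist ((f ^^ n) (fst p)) ((f ^^ n) (snd p))"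
    if S: "opene (X \<times> X) S" for S N
  proof -
    obtain u v where "(u, v) \<in> S" using S unfolding opene_def by auto
    moreover have "openin (top_of_set (X \<times> X)) S" using S unfolding opene_def by simp
    ultimately obtain V W where "openin (top_of_set X) V" "u \<in> V"
      "openin (top_of_set X) W" "v \<in> W" and VW: "V \<times> W \<subseteq> S"
      by (rule Times_in_interior_subtopology)
    then have V: "opene X V" and W: "opene X W" unfolding opene_def by auto
    define r where "r = (dist a b - e) / 2"
    have "r > 0" using ab by (simp add: r_def)
    then have balls: "opene X (X \<inter> ball a r)" "opene X (X \<inter> ball b r)"
      using opene_ball ab by blast+
    obtain n where "n \<ge> N" and
      n: "\<forall>(U, V)\<in>{(V, X \<inter> ball a r), (W, X \<inter> ball b r)}. \<exists>u\<in>U. (f ^^ n) u \<in> V"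
      using infinite_common_hitting_times[OF ds wm,
          of "{(V, X \<inter> ball a r), (W, X \<inter> ball b r)}" N] V W balls by auto
    then obtain x y where xy: "x \<in> V" "y \<in> W"
      and near: "dist a ((f ^^ n) x) < r" "dist b ((f ^^ n) y) < r"
      by auto
    then have "e < dist ((f ^^ n) x) ((f ^^ n) y)"
      by (intro dist_greater_if_near) (simp_all add: r_def)
    then show ?thesis using xy VW \<open>n \<ge> N\<close> by (intro bexI[of _ "(x, y)"]) auto
  qed
  moreover have "opene (X \<times> X) (U \<times> U)"
    using U by (auto simp: opene_def intro: openin_Times)
  moreover have "compact (X \<times> X)"
    using ds by (simp add: dynamical_system_def compact_Times)
  ultimately have "\<exists>p\<in>U \<times> U. ereal e \<le>
      limsup (\<lambda>n. ereal (dist ((f ^^ n) (fst p)) ((f ^^ n) (snd p))))"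
    using continuous_on_dist_iterates[OF ds]
    by (intro generic_limsup_ge[where K = "X \<times> X"])
  then show ?thesis by auto
qed

text \<open>The point \<open>x\<close> is fixed and the separating time for \<open>f\<^sup>k x\<close> depends on where \<open>f\<^sup>k x\<close> lies, so the
  set \<open>U\<close> must be prepared for all positions of \<open>f\<^sup>k x\<close> at once.  Compactness leaves finitely many of
  them, and weak mixing treats finitely many targets at one time \<open>k\<close>.\<close>

lemma ex_limsup_ge_of_all_separated:
  fixes X :: "'a::metric_space set"
  assumes ds: "dynamical_system X f" and wm: "weakly_mixing X f"
    and sep: "\<And>u. u \<in> X \<Longrightarrow> \<exists>z\<in>X. \<exists>n. e < dist ((f ^^ n) u) ((f ^^ n) z)"
    and x: "x \<in> X" and U: "opene X U"
  shows "\<exists>y\<in>U. ereal e \<le> limsup (\<lambda>n. ereal (dist ((f ^^ n) x) ((f ^^ n) y)))"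
proof -
  \<comment> \<open>One time separates every point of \<open>A\<close> from every point of \<open>P\<close>; the time may depend on the pair
    \<open>A\<close>, \<open>P\<close>.\<close>
  define good where "good A P \<longleftrightarrow> opene X P \<and>
    (\<exists>n. \<forall>u\<in>A. \<forall>z\<in>P. e < dist ((f ^^ n) u) ((f ^^ n) z))" for A P
  define C where "C = {A. openin (top_of_set X) A \<and> (\<exists>P. good A P)}"
  have "X \<subseteq> \<Union>C"
  proof
    fix u assume u: "u \<in> X"
    then obtain z n where z: "z \<in> X" and n: "e < dist ((f ^^ n) u) ((f ^^ n) z)"
      using sep[OF u] by blast
    define S where "S = X \<times> X \<inter> (\<lambda>p. dist ((f ^^ n) (fst p)) ((f ^^ n) (snd p))) -` {e<..}"
    have "(u, z) \<in> S" unfolding S_def using u z n by simp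
    moreover have "openin (top_of_set (X \<times> X)) S"
      unfolding S_def
      by (rule continuous_openin_preimage_gen[OF continuous_on_dist_iterates[OF ds]]) simp
    ultimately obtain A P where A: "openin (top_of_set X) A" "u \<in> A"
      and P: "openin (top_of_set X) P" "z \<in> P" and AP: "A \<times> P \<subseteq> S"
      by (rule Times_in_interior_subtopology)
    have "good A P" unfolding good_def opene_def
    proof (intro conjI exI ballI)
      show "e < dist ((f ^^ n) u) ((f ^^ n) z)" if "u \<in> A" "z \<in> P" for u z
        using AP that unfolding S_def by auto
    qed (use P in auto)
    with A show "u \<in> \<Union>C" unfolding C_def by blast
  qed
  moreover have "compact X" using ds by (simp add: dynamical_system_def)
  ultimately obtain D where D: "D \<subseteq> C" "finite D" "X \<subseteq> \<Union>D"
    unfolding compact_eq_openin_cover C_def by (metis (no_types, lifting) mem_Collect_eq)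
  then have "\<forall>A\<in>D. \<exists>P. good A P" unfolding C_def by blast
  then obtain partner where partner: "\<And>A. A \<in> D \<Longrightarrow> good A (partner A)"
    using bchoice[of D good] by blast

  have "\<exists>y\<in>W. \<exists>n\<ge>N. e < dist ((f ^^ n) x) ((f ^^ n) y)" if W: "opene X W" for W N
  proof -
    define Q where "Q = (\<lambda>A. (W, partner A)) ` D"
    have "finite Q" using D by (simp add: Q_def)
    moreover have "opene X U \<and> opene X V" if "(U, V) \<in> Q" for U V
      using that W partner unfolding Q_def good_def by auto
    ultimately obtain k where "k \<ge> N" and k: "\<forall>(U, V)\<in>Q. \<exists>u\<in>U. (f ^^ k) u \<in> V"
      using infinite_common_hitting_times[OF ds wm] by blast
    obtain A where A: "A \<in> D" "(f ^^ k) x \<in> A"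
      using D iterate_mem[OF ds x] by blast
    then obtain y where y: "y \<in> W" "(f ^^ k) y \<in> partner A"
      using k unfolding Q_def by auto
    obtain n where "e < dist ((f ^^ n) ((f ^^ k) x)) ((f ^^ n) ((f ^^ k) y))"
      using partner[OF A(1)] A(2) y(2) unfolding good_def by blast
    then have "e < dist ((f ^^ (n + k)) x) ((f ^^ (n + k)) y)"
      by (simp add: iterate_add_apply)
    then show ?thesis using y(1) \<open>k \<ge> N\<close> trans_le_add2 by blast
  qed
  moreover have "continuous_on X (\<lambda>y. dist ((f ^^ n) x) ((f ^^ n) y))" for n
    by (intro continuous_on_dist continuous_on_const continuous_on_iterate ds)
  ultimately show ?thesis
    using \<open>compact X\<close> U by (intro generic_limsup_ge[where K = X])
qed

text \<open>The partner of \<open>u\<close> is taken from the orbit of \<open>u\<close> itself: if \<open>f\<^sup>j\<close> carries \<open>f\<^sup>n u\<close> close to \<open>b\<close>, then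
  \<open>f\<^sup>n\<close> carries \<open>f\<^sup>j u\<close> close to \<open>b\<close>.\<close>

lemma minimal_all_separated:
  fixes X :: "'a::metric_space set"
  assumes ds: "dynamical_system X f" and min: "minimal_system X f"
    and ab: "a \<in> X" "b \<in> X" "e < dist a b" and u: "u \<in> X"
  shows "\<exists>z\<in>X. \<exists>n. e < dist ((f ^^ n) u) ((f ^^ n) z)"
proof -
  have visit: "\<exists>n. dist c ((f ^^ n) w) < r" if "w \<in> X" "c \<in> X" "r > 0" for w c r
  proof -
    have "c \<in> closure (range (\<lambda>n. (f ^^ n) w))"
      using min that unfolding minimal_system_def by blast
    then show ?thesis using \<open>r > 0\<close> by (auto simp: closure_approachable dist_commute)
  qed
  define r where "r = (dist a b - e) / 2"
  have "r > 0" using ab by (simp add: r_def)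
  then obtain n where n: "dist a ((f ^^ n) u) < r" using visit[OF u ab(1)] by blast
  obtain j where "dist b ((f ^^ j) ((f ^^ n) u)) < r"
    using visit[OF iterate_mem[OF ds u] ab(2) \<open>r > 0\<close>] by blast
  then have j: "dist b ((f ^^ n) ((f ^^ j) u)) < r"
    by (metis iterate_add_apply add.commute)
  have "e < dist ((f ^^ n) u) ((f ^^ n) ((f ^^ j) u))"
    using n j by (intro dist_greater_if_near) (simp_all add: r_def)
  then show ?thesis using iterate_mem[OF ds u] by blast
qed

section \<open>The Lyapunov numbers\<close>

lemma ex_dist_greater_if_less_diameter:
  fixes X :: "'a::metric_space set"
  assumes "dynamical_system X f" "e < diameter X"
  shows "\<exists>a\<in>X. \<exists>b\<in>X. e < dist a b"
proof (cases "e < 0")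
  \<comment> \<open>A negative bound is exceeded by the distance of a point to itself, even in a one-point space.\<close>
  case True
  then show ?thesis using assms(1) unfolding dynamical_system_def
    by (metis dist_self ex_in_conv)
next
  case False
  obtain d where d: "e < d" "d < diameter X" using assms(2) dense by blast
  then obtain a b where "a \<in> X" "b \<in> X" "d < dist a b"
    using diameter_lower_bounded[OF bounded_dynamical_system[OF assms(1)], of d] False by auto
  then show ?thesis using d by force
qed

lemma Lyap_d_eq_diameter:
  fixes X :: "'a::metric_space set"
  assumes ds: "dynamical_system X f" and wm: "weakly_mixing X f"
  shows "Lyap_d X f = diameter X" "Lyap_d_bar X f = diameter X"
proof -
  define A where "A = {\<epsilon>::real. \<forall>U. opene X U \<longrightarrow>
     (\<exists>x\<in>U. \<exists>y\<in>U. limsup (\<lambda>n. ereal (dist ((f ^^ n) x) ((f ^^ n) y))) > ereal \<epsilon>)}"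
  define B where "B = {\<epsilon>::real. \<forall>U. opene X U \<longrightarrow>
     (\<exists>x\<in>U. \<exists>y\<in>U. \<exists>n>0. dist ((f ^^ n) x) ((f ^^ n) y) > \<epsilon>)}"
  have "{..<diameter X} \<subseteq> A"
  proof
    fix e assume "e \<in> {..<diameter X}"
    then obtain d where d: "e < d" "d < diameter X" using dense by auto
    then obtain a b where "a \<in> X" "b \<in> X" "d < dist a b"
      using ex_dist_greater_if_less_diameter[OF ds] by blast
    then have "\<exists>x\<in>U. \<exists>y\<in>U. ereal d \<le> limsup (\<lambda>n. ereal (dist ((f ^^ n) x) ((f ^^ n) y)))"
      if "opene X U" for U using ex_pair_limsup_ge[OF ds wm that] by blast
    then show "e \<in> A" unfolding A_def using d(1) less_le_trans[of "ereal e" "ereal d"] by fastforce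
  qed
  moreover have "A \<subseteq> B"
  proof
    fix e assume e: "e \<in> A"
    have "\<exists>x\<in>U. \<exists>y\<in>U. \<exists>n>0. dist ((f ^^ n) x) ((f ^^ n) y) > e" if U: "opene X U" for U
    proof -
      obtain x y where "x \<in> U" "y \<in> U"
        and "limsup (\<lambda>n. ereal (dist ((f ^^ n) x) ((f ^^ n) y))) > ereal e"
        using e U unfolding A_def by blast
      then have "\<exists>n\<ge>1. e < dist ((f ^^ n) x) ((f ^^ n) y)"
        by (intro ex_greater_if_limsup_greater)
      then have "\<exists>n>0. e < dist ((f ^^ n) x) ((f ^^ n) y)"
        by (auto simp: Suc_le_eq)
      then show ?thesis using \<open>x \<in> U\<close> \<open>y \<in> U\<close> by blast
    qed
    then show "e \<in> B" unfolding B_def by blast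
  qed
  moreover have "B \<subseteq> {..diameter X}"
  proof
    fix e assume e: "e \<in> B"
    have "opene X X" using ds by (simp add: opene_def dynamical_system_def)
    then obtain x y n where "x \<in> X" "y \<in> X" "e < dist ((f ^^ n) x) ((f ^^ n) y)"
      using e unfolding B_def by blast
    then show "e \<in> {..diameter X}" using dist_iterates_le_diameter[OF ds, of x y n] by simp
  qed
  ultimately have "Sup B = diameter X" "Sup A = diameter X"
    by (meson Sup_eqI_lessThan_atMost order_trans)+
  then show "Lyap_d X f = diameter X" "Lyap_d_bar X f = diameter X"
    by (simp_all add: Lyap_d_def Lyap_d_bar_def A_def B_def)
qed

definition separation_bounds :: "'a::metric_space set \<Rightarrow> ('a \<Rightarrow> 'a) \<Rightarrow> real set" where
  "separation_bounds X f =
    {\<epsilon>. \<forall>u\<in>X. \<exists>z\<in>X. \<exists>n. dist ((f ^^ n) u) ((f ^^ n) z) > \<epsilon>}"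

lemma separation_bounds_le_diameter:
  fixes X :: "'a::metric_space set"
  assumes ds: "dynamical_system X f"
  shows "separation_bounds X f \<subseteq> {..diameter X}"
proof
  fix e assume e: "e \<in> separation_bounds X f"
  obtain u where u: "u \<in> X" using ds unfolding dynamical_system_def by blast
  then obtain z n where "z \<in> X" "e < dist ((f ^^ n) u) ((f ^^ n) z)"
    using e unfolding separation_bounds_def by blast
  then show "e \<in> {..diameter X}" using dist_iterates_le_diameter[OF ds u, of z n] by simp
qed

text \<open>Sensitivity in the limes superior sense implies sensitivity, which implies separation from some
  point of the whole space.  Weak mixing closes this cycle up to an arbitrarily small loss in the
  bound, so the three suprema agree.\<close>

lemma Lyap_r_eq_Sup_separation_bounds:
  fixes X :: "'a::metric_space set"
  assumes ds: "dynamical_system X f" and wm: "weakly_mixing X f"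
  shows "Lyap_r X f = Sup (separation_bounds X f)"
    and "Lyap_r_bar X f = Sup (separation_bounds X f)"
proof -
  define A where "A = {\<epsilon>::real. \<forall>x\<in>X. \<forall>U. openin (top_of_set X) U \<and> x \<in> U \<longrightarrow>
     (\<exists>y\<in>U. limsup (\<lambda>n. ereal (dist ((f ^^ n) x) ((f ^^ n) y))) > ereal \<epsilon>)}"
  define B where "B = {\<epsilon>::real. \<forall>x\<in>X. \<forall>U. nbhd X x U \<longrightarrow>
     (\<exists>y\<in>U. \<exists>n. dist ((f ^^ n) x) ((f ^^ n) y) > \<epsilon>)}"
  have below: "e \<in> A" if d: "d \<in> separation_bounds X f" and "e < d" for d e
  proof -
    have sep: "\<exists>z\<in>X. \<exists>n. d < dist ((f ^^ n) u) ((f ^^ n) z)" if "u \<in> X" for u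
      using d that unfolding separation_bounds_def by blast
    have "\<exists>y\<in>U. limsup (\<lambda>n. ereal (dist ((f ^^ n) x) ((f ^^ n) y))) > ereal e"
      if "x \<in> X" "openin (top_of_set X) U" "x \<in> U" for x U
    proof -
      have "opene X U" using that by (auto simp: opene_def)
      then obtain y where "y \<in> U"
        "ereal d \<le> limsup (\<lambda>n. ereal (dist ((f ^^ n) x) ((f ^^ n) y)))"
        using ex_limsup_ge_of_all_separated[OF ds wm sep \<open>x \<in> X\<close>] by blast
      moreover have "ereal e < ereal d" using \<open>e < d\<close> by simp
      ultimately show ?thesis using less_le_trans by blast
    qed
    then show ?thesis unfolding A_def by blast
  qed
  have "A \<subseteq> B"
  proof
    fix e assume e: "e \<in> A"
    have "\<exists>y\<in>U. \<exists>n. dist ((f ^^ n) x) ((f ^^ n) y) > e" if "x \<in> X" and U: "nbhd X x U" for x U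
    proof -
      obtain V where V: "openin (top_of_set X) V" "x \<in> V" "V \<subseteq> U"
        using U unfolding nbhd_def by blast
      then obtain y where "y \<in> V"
        and y: "limsup (\<lambda>n. ereal (dist ((f ^^ n) x) ((f ^^ n) y))) > ereal e"
        using e \<open>x \<in> X\<close> unfolding A_def by blast
      then show ?thesis using V ex_greater_if_limsup_greater[OF y] by blast
    qed
    then show "e \<in> B" unfolding B_def by blast
  qed
  have "B \<subseteq> separation_bounds X f"
  proof
    fix e assume e: "e \<in> B"
    have "\<exists>z\<in>X. \<exists>n. e < dist ((f ^^ n) u) ((f ^^ n) z)" if "u \<in> X" for u
    proof -
      have "nbhd X u X" unfolding nbhd_def using \<open>u \<in> X\<close> by (intro conjI exI[of _ X]) auto
      then show ?thesis using e \<open>u \<in> X\<close> unfolding B_def by blast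
    qed
    then show "e \<in> separation_bounds X f" unfolding separation_bounds_def by blast
  qed
  have bdd: "bdd_above (separation_bounds X f)"
    using separation_bounds_le_diameter[OF ds] by (rule bdd_above_mono[OF bdd_above_Iic])
  have "Sup A = Sup (separation_bounds X f)"
    using \<open>A \<subseteq> B\<close> \<open>B \<subseteq> separation_bounds X f\<close> bdd below
    by (intro Sup_eq_if_interleaved) blast+
  moreover have "Sup B = Sup (separation_bounds X f)"
    using \<open>A \<subseteq> B\<close> \<open>B \<subseteq> separation_bounds X f\<close> bdd below
    by (intro Sup_eq_if_interleaved) blast+
  ultimately show "Lyap_r X f = Sup (separation_bounds X f)"
    "Lyap_r_bar X f = Sup (separation_bounds X f)"
    by (simp_all add: Lyap_r_def Lyap_r_bar_def A_def B_def)
qed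

lemma minimal_Sup_separation_bounds:
  fixes X :: "'a::metric_space set"
  assumes ds: "dynamical_system X f" and min: "minimal_system X f"
  shows "Sup (separation_bounds X f) = diameter X"
proof (rule Sup_eqI_lessThan_atMost)
  show "{..<diameter X} \<subseteq> separation_bounds X f"
  proof
    fix e assume "e \<in> {..<diameter X}"
    then obtain a b where ab: "a \<in> X" "b \<in> X" "e < dist a b"
      using ex_dist_greater_if_less_diameter[OF ds] by blast
    show "e \<in> separation_bounds X f"
      using minimal_all_separated[OF ds min ab] unfolding separation_bounds_def by blast
  qed
qed (rule separation_bounds_le_diameter[OF ds])

theorem theorem4p1:
  fixes X :: "'a::metric_space set" and f :: "'a \<Rightarrow> 'a"
  assumes "dynamical_system X f"
    and "weakly_mixing X f"
  shows "(Lyap_d X f = Lyap_d_bar X f \<and> Lyap_d_bar X f = diameter X)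
    \<and> Lyap_r X f = Lyap_r_bar X f
    \<and> (minimal_system X f \<longrightarrow>
         Lyap_r X f = Lyap_r_bar X f \<and> Lyap_r_bar X f = Lyap_d X f \<and>
         Lyap_d X f = Lyap_d_bar X f \<and> Lyap_d_bar X f = diameter X)"
  using Lyap_d_eq_diameter[OF assms] Lyap_r_eq_Sup_separation_bounds[OF assms]
    minimal_Sup_separation_bounds[OF assms(1)] by auto

end
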